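(* Let $d\geqslant 2$, let $\boldsymbol{q}\colon[0,\infty)\to\mathbb{R}^d$ be piecewise continuous, write $q(t)=q_1(t)+\dots+q_d(t)$, and set $Q(t)=-q(t)\,\mathbb{1}+C_{\boldsymbol{q}(t)}$ for $t\geqslant 0$. Then the Cauchy problem $\dot M=MQ$ with $M(0)=\mathbb{1}$ has the solution $M(t)=M_{\boldsymbol{x}(t)}=(1-x(t))\,\mathbb{1}+C_{\boldsymbol{x}(t)}$ for $t\geqslant 0$, with $x(t)=x_1(t)+\dots+x_d(t)$ and the $\mathbb{R}^d$-valued function $$\boldsymbol{x}(t)=\exp\Bigl(-\int_0^t q(\rho)\,d\rho\Bigr)\int_0^t \boldsymbol{q}(\tau)\exp\Bigl(\int_0^\tau q(\sigma)\,d\sigma\Bigr)d\tau .$$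
   Context: For a row vector $\boldsymbol{x}=(x_1,\dots,x_d)\in\mathbb{R}^d$, $C_{\boldsymbol{x}}$ is the real $d\times d$ matrix all of whose rows equal $\boldsymbol{x}$; $\mathbb{1}$ is the identity matrix. Piecewise continuous means continuous except for isolated jump points; a solution of the Cauchy problem is a continuous matrix function on $[0,\infty)$ with the given initial value that satisfies the ODE on each continuity interval of $Q$. *)

theory Defs
  imports "HOL-Analysis.Analysis"
begin

definition coord_sum :: "real ^ 'd \<Rightarrow> real" where
  "coord_sum x = (\<Sum>i\<in>UNIV. x $ i)"

definition equal_rows :: "real ^ 'd \<Rightarrow> real ^ 'd ^ 'd" where
  "equal_rows x = (\<chi> i j. x $ j)"

definition discontinuities ::
    "real set \<Rightarrow> (real \<Rightarrow> 'a::topological_space) \<Rightarrow> real set" where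
  "discontinuities S f = {t \<in> S. \<not> continuous (at t within S) f}"

text \<open>
  Continuous except for isolated jump points. At a jump the one-sided limits exist (and lie in
  the codomain, hence are finite); the value of the function there is unrestricted. At an endpoint
  of the domain \<open>S\<close> only one of the two limits is a condition, since the other filter is trivial.
  Being isolated is understood inside the set of discontinuities, so the customary local finiteness
  of that set is a special case.
\<close>

definition piecewise_continuous_on ::
    "real set \<Rightarrow> (real \<Rightarrow> 'a::topological_space) \<Rightarrow> bool" where
  "piecewise_continuous_on S f \<longleftrightarrow>
     (\<forall>t \<in> discontinuities S f.
        t isolated_in (discontinuities S f) \<and>
        (\<exists>l. (f \<longlongrightarrow> l) (at t within (S \<inter> {..<t}))) \<and>
        (\<exists>r. (f \<longlongrightarrow> r) (at t within (S \<inter> {t<..}))))"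

text \<open>
  Solutions on \<open>[0, \<infinity>)\<close> of the initial value problem \<open>M' = M Q\<close>, \<open>M 0 = M0\<close>. The equation is
  required on every interval to which \<open>Q\<close> restricts continuously; the derivative is one-sided at
  those endpoints that belong to the interval.
\<close>

definition cauchy_solution ::
    "(real \<Rightarrow> real ^ 'd ^ 'd) \<Rightarrow> real ^ 'd ^ 'd \<Rightarrow> (real \<Rightarrow> real ^ 'd ^ 'd) \<Rightarrow> bool" where
  "cauchy_solution Q M0 M \<longleftrightarrow>
     continuous_on {0..} M \<and> M 0 = M0 \<and>
     (\<forall>I. is_interval I \<and> I \<subseteq> {0..} \<and> continuous_on I Q \<longrightarrow>
        (\<forall>t\<in>I. (M has_vector_derivative (M t ** Q t)) (at t within I)))"

end

theory Submission
  imports Defs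
begin

text \<open>
  Write \<open>h t\<close> for the integral of \<open>coord_sum (q \<rho>)\<close> over \<open>{0..t}\<close>, and \<open>y t\<close> for the integral of
  \<open>exp (h \<tau>) *\<^sub>R q \<tau>\<close> over the same interval, so that \<open>x t = exp (- h t) *\<^sub>R y t\<close>. This is variation of
  constants: wherever the integrands are continuous, \<open>x' = q - coord_sum q *\<^sub>R x\<close>. The matrix \<open>M\<close> is the
  affine image \<open>mat 1 + L x\<close> of \<open>x\<close>, where \<open>L v = equal_rows v - coord_sum v *\<^sub>R mat 1\<close> is linear, and
  \<open>Q = L q\<close>. Hence \<open>M' = L (q - coord_sum q *\<^sub>R x)\<close>. That this is \<open>M ** Q\<close> is an algebraic identity
  (\<open>matrix_mult_identity_plus_equal_rows\<close>); it rests on the fact that the product of the equal-row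
  matrices of \<open>u\<close> and \<open>v\<close> is \<open>coord_sum u\<close> times that of \<open>v\<close>.

  The analytic content is that the integrals exist and behave well. A discontinuity set of isolated
  points may still accumulate at a point of continuity, so a bounded interval need not split into
  finitely many intervals of continuity. What survives is that \<open>q\<close> has one-sided limits at every point,
  and such a regulated function is a uniform limit of step functions, hence integrable
  (\<open>regulated_integrable\<close>). Indefinite integrals are then continuous, and they are differentiable
  relative to every interval on which the integrand restricts to a continuous function
  (\<open>indefinite_integral_has_vector_derivative_within_interval\<close>).

  The differential equation is required where \<open>Q\<close> is continuous, and there \<open>q\<close> is continuous too,
  because for \<open>CARD('d) \<ge> 2\<close> each coordinate of \<open>q\<close> is an off-diagonal entry of \<open>Q\<close>. For \<open>CARD('d) = 1\<close>
  this inference fails, as \<open>Q\<close> then vanishes identically.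
\<close>

section \<open>Integrability of regulated functions\<close>

lemma step_function_integrable:
  fixes l c r :: "'a::banach" and u v x :: real
  assumes "x \<in> {u..v}"
  shows "(\<lambda>y. if y < x then l else if y = x then c else r) integrable_on {u..v}"
    (is "?g integrable_on _")
proof (rule Henstock_Kurzweil_Integration.integrable_combine)
  show "u \<le> x" "x \<le> v" using assms by auto
  show "?g integrable_on {u..x}"
    by (rule integrable_spike_finite[of "{x}" _ _ "\<lambda>_. l"]) auto
  show "?g integrable_on {x..v}"
    by (rule integrable_spike_finite[of "{x}" _ _ "\<lambda>_. r"]) auto
qed

text \<open>
  Fix a tolerance \<open>e\<close>. Around each \<open>x\<close> the function stays within \<open>e\<close> of its left limit on the left and
  of its right limit on the right, so on a small interval it is approximated by a step function with a
  single exceptional value at \<open>x\<close>. A tagged division fine for these neighbourhoods (Cousin's lemma)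
  patches the local approximations together.
\<close>

lemma regulated_integrable:
  fixes f :: "real \<Rightarrow> 'a::banach"
  assumes left: "\<And>x. x \<in> {a..b} \<Longrightarrow> \<exists>l. (f \<longlongrightarrow> l) (at x within {a..b} \<inter> {..<x})"
    and right: "\<And>x. x \<in> {a..b} \<Longrightarrow> \<exists>r. (f \<longlongrightarrow> r) (at x within {a..b} \<inter> {x<..})"
  shows "f integrable_on {a..b}"
proof -
  have "\<exists>g. (\<forall>x\<in>{a..b}. norm (f x - g x) \<le> e) \<and> g integrable_on {a..b}" if "e > 0" for e
  proof -
    define approx where "approx i \<longleftrightarrow> (\<exists>g. (\<forall>y\<in>i. norm (f y - g y) \<le> e) \<and> g integrable_on i)" for i
    have local: "\<exists>d>0. \<forall>u v. x \<in> {u..v} \<and> {u..v} \<subseteq> ball x d \<and> {u..v} \<subseteq> {a..b} \<longrightarrow> approx {u..v}"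
      if x: "x \<in> {a..b}" for x
    proof -
      obtain l where l: "(f \<longlongrightarrow> l) (at x within {a..b} \<inter> {..<x})" using left[OF x] by blast
      obtain r where r: "(f \<longlongrightarrow> r) (at x within {a..b} \<inter> {x<..})" using right[OF x] by blast
      obtain d1 where d1: "d1 > 0" "\<And>y. y \<in> {a..b} \<Longrightarrow> y < x \<Longrightarrow> dist y x < d1 \<Longrightarrow> dist (f y) l < e"
        using tendstoD[OF l \<open>e > 0\<close>] unfolding eventually_at by force
      obtain d2 where d2: "d2 > 0" "\<And>y. y \<in> {a..b} \<Longrightarrow> x < y \<Longrightarrow> dist y x < d2 \<Longrightarrow> dist (f y) r < e"
        using tendstoD[OF r \<open>e > 0\<close>] unfolding eventually_at by force
      show ?thesis
      proof (intro exI[of _ "min d1 d2"] conjI allI impI)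
        show "min d1 d2 > 0" using d1 d2 by simp
        fix u v assume uv: "x \<in> {u..v} \<and> {u..v} \<subseteq> ball x (min d1 d2) \<and> {u..v} \<subseteq> {a..b}"
        let ?g = "\<lambda>y. if y < x then l else if y = x then f x else r"
        have "norm (f y - ?g y) \<le> e" if "y \<in> {u..v}" for y
        proof -
          have "y \<in> {a..b}" "dist y x < d1" "dist y x < d2"
            using uv that by (auto simp: subset_iff dist_commute)
          then show ?thesis
            using d1(2)[of y] d2(2)[of y] \<open>e > 0\<close> by (auto simp: dist_norm)
        qed
        moreover have "?g integrable_on {u..v}" using uv by (intro step_function_integrable) auto
        ultimately show "approx {u..v}" unfolding approx_def by (intro exI[of _ ?g]) blast
      qed
    qed
    have "\<exists>d. \<forall>x\<in>{a..b}. d x > 0 \<and>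
        (\<forall>u v. x \<in> {u..v} \<and> {u..v} \<subseteq> ball x (d x) \<and> {u..v} \<subseteq> {a..b} \<longrightarrow> approx {u..v})"
      by (rule bchoice) (use local in blast)
    then obtain d where d: "\<And>x. x \<in> {a..b} \<Longrightarrow> d x > 0"
      "\<And>x u v. x \<in> {a..b} \<Longrightarrow> x \<in> {u..v} \<Longrightarrow> {u..v} \<subseteq> ball x (d x) \<Longrightarrow> {u..v} \<subseteq> {a..b}
        \<Longrightarrow> approx {u..v}"
      by blast
    \<comment> \<open>A gauge has to be positive everywhere, also outside \<open>{a..b}\<close>.\<close>
    define \<delta> where "\<delta> x = (if x \<in> {a..b} then d x else 1)" for x
    have "gauge (\<lambda>x. ball x (\<delta> x))"
      by (rule gauge_ball_dependent) (use d(1) in \<open>auto simp: \<delta>_def\<close>)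
    then obtain p where p: "p tagged_division_of {a..b}" "(\<lambda>x. ball x (\<delta> x)) fine p"
      using fine_division_exists_real by blast
    have "approx k" if xk: "(x, k) \<in> p" for x k
    proof -
      obtain u v where k: "k = {u..v}" using tagged_division_ofD(4)[OF p(1) xk] by auto
      have "x \<in> k" "k \<subseteq> {a..b}" "k \<subseteq> ball x (\<delta> x)"
        using tagged_division_ofD(2,3)[OF p(1) xk] fineD[OF p(2) xk] by auto
      then show ?thesis using d(2)[of x u v] k by (auto simp: \<delta>_def subset_iff)
    qed
    then have approx: "\<forall>k\<in>snd ` p. \<exists>g. (\<forall>y\<in>k. norm (f y - g y) \<le> e) \<and> g integrable_on k"
      unfolding approx_def by auto
    have division: "snd ` p division_of cbox a b"
      using division_of_tagged_division[OF p(1)] by simp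
    obtain g where "\<forall>x\<in>cbox a b. norm (f x - g x) \<le> e" "g integrable_on cbox a b"
      by (rule approximable_on_division[OF less_imp_le[OF \<open>e > 0\<close>] division approx])
    then show ?thesis by (intro exI[of _ g]) simp
  qed
  then show ?thesis using integrable_uniform_limit[of a b f] by simp
qed

section \<open>Piecewise continuous functions\<close>

lemma piecewise_continuous_on_left_limit:
  assumes "piecewise_continuous_on S f" "t \<in> S"
  shows "\<exists>l. (f \<longlongrightarrow> l) (at t within S \<inter> {..<t})"
proof (cases "t \<in> discontinuities S f")
  case True then show ?thesis using assms unfolding piecewise_continuous_on_def by blast
next
  case False
  then have "(f \<longlongrightarrow> f t) (at t within S)"
    using assms(2) by (simp add: discontinuities_def continuous_within)
  then show ?thesis using tendsto_within_subset by blast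
qed

lemma piecewise_continuous_on_right_limit:
  assumes "piecewise_continuous_on S f" "t \<in> S"
  shows "\<exists>r. (f \<longlongrightarrow> r) (at t within S \<inter> {t<..})"
proof (cases "t \<in> discontinuities S f")
  case True then show ?thesis using assms unfolding piecewise_continuous_on_def by blast
next
  case False
  then have "(f \<longlongrightarrow> f t) (at t within S)"
    using assms(2) by (simp add: discontinuities_def continuous_within)
  then show ?thesis using tendsto_within_subset by blast
qed

lemma piecewise_continuous_on_integrable:
  fixes f :: "real \<Rightarrow> 'a::banach"
  assumes "piecewise_continuous_on S f" "{a..b} \<subseteq> S"
  shows "f integrable_on {a..b}"
proof (rule regulated_integrable)
  fix x assume x: "x \<in> {a..b}"
  have "\<exists>l. (f \<longlongrightarrow> l) (at x within S \<inter> {..<x})" "\<exists>r. (f \<longlongrightarrow> r) (at x within S \<inter> {x<..})"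
    using piecewise_continuous_on_left_limit[OF assms(1)]
      piecewise_continuous_on_right_limit[OF assms(1)] assms(2) x by blast+
  moreover have "{a..b} \<inter> {..<x} \<subseteq> S \<inter> {..<x}" "{a..b} \<inter> {x<..} \<subseteq> S \<inter> {x<..}"
    using assms(2) by auto
  ultimately show "\<exists>l. (f \<longlongrightarrow> l) (at x within {a..b} \<inter> {..<x})"
    "\<exists>r. (f \<longlongrightarrow> r) (at x within {a..b} \<inter> {x<..})"
    by (meson tendsto_within_subset)+
qed

text \<open>
  Provides the integrability of the integrand \<open>exp (h \<tau>) *\<^sub>R q \<tau>\<close> of the variation of constants formula,
  whose first factor is continuous.
\<close>

lemma piecewise_continuous_on_scaleR:
  fixes f :: "real \<Rightarrow> 'a::real_normed_vector"
  assumes c: "continuous_on S c" and f: "piecewise_continuous_on S f"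
  shows "piecewise_continuous_on S (\<lambda>t. c t *\<^sub>R f t)"
proof -
  have c_lim: "(c \<longlongrightarrow> c t) (at t within S \<inter> T)" if "t \<in> S" for t T
    by (rule tendsto_within_subset) (use c that in \<open>auto simp: continuous_on_def\<close>)
  have sub: "discontinuities S (\<lambda>t. c t *\<^sub>R f t) \<subseteq> discontinuities S f"
    using c by (auto simp: discontinuities_def continuous_on_eq_continuous_within
        intro: continuous_scaleR)
  show ?thesis
    unfolding piecewise_continuous_on_def
  proof (intro ballI conjI)
    fix t assume t: "t \<in> discontinuities S (\<lambda>t. c t *\<^sub>R f t)"
    then have t': "t \<in> discontinuities S f" and tS: "t \<in> S"
      using sub by (auto simp: discontinuities_def)
    show "t isolated_in discontinuities S (\<lambda>t. c t *\<^sub>R f t)"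
      using f t t' sub isolated_in_subset unfolding piecewise_continuous_on_def by blast
    show "\<exists>l. ((\<lambda>t. c t *\<^sub>R f t) \<longlongrightarrow> l) (at t within S \<inter> {..<t})"
      using tendsto_scaleR[OF c_lim[OF tS]] piecewise_continuous_on_left_limit[OF f tS] by blast
    show "\<exists>l. ((\<lambda>t. c t *\<^sub>R f t) \<longlongrightarrow> l) (at t within S \<inter> {t<..})"
      using tendsto_scaleR[OF c_lim[OF tS]] piecewise_continuous_on_right_limit[OF f tS] by blast
  qed
qed

section \<open>Indefinite integrals on the half-line\<close>

lemma indefinite_integral_continuous_on_half_line:
  fixes f :: "real \<Rightarrow> 'a::banach"
  assumes "\<And>b. f integrable_on {a..b}"
  shows "continuous_on {a..} (\<lambda>t. integral {a..t} f)"
  unfolding continuous_on_eq_continuous_within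
proof
  fix t assume "t \<in> {a..}"
  have "continuous (at t within {a..t+1}) (\<lambda>t. integral {a..t} f)"
    using indefinite_integral_continuous_1[OF assms, of "t+1"] \<open>t \<in> {a..}\<close>
    by (simp add: continuous_on_eq_continuous_within)
  moreover have "at t within {a..} = at t within {a..t+1}"
    by (rule at_within_nhd[of t "{..<t+1}"]) auto
  ultimately show "continuous (at t within {a..}) (\<lambda>t. integral {a..t} f)" by simp
qed

text \<open>
  Fundamental theorems of calculus speak of compact intervals; this reduces arbitrary intervals,
  including one-point ones, to them. Since \<open>t\<close> may be an endpoint of \<open>I\<close>, the compact interval has to
  reach beyond \<open>t\<close> exactly on those sides on which \<open>I\<close> does.
\<close>

lemma at_within_interval_eq_at_within_Icc:
  fixes t :: real
  assumes "is_interval I" "t \<in> I"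
  obtains a b where "a \<le> t" "t \<le> b" "{a..b} \<subseteq> I" "at t within I = at t within {a..b}"
proof -
  obtain a where a: "a \<in> I" "a \<le> t" "a < t \<or> I \<subseteq> {t..}"
  proof (cases "I \<subseteq> {t..}")
    case True then show ?thesis using that[of t] assms by auto
  next
    case False
    then obtain a where "a \<in> I" "a < t" by force
    then show ?thesis using that[of a] by auto
  qed
  obtain b where b: "b \<in> I" "t \<le> b" "t < b \<or> I \<subseteq> {..t}"
  proof (cases "I \<subseteq> {..t}")
    case True then show ?thesis using that[of t] assms by auto
  next
    case False
    then obtain b where "b \<in> I" "t < b" by force
    then show ?thesis using that[of b] by auto
  qed
  have sub: "{a..b} \<subseteq> I"
    using mem_is_interval_1_I[OF assms(1) a(1) b(1)] by auto
  define U where "U = (if a < t then {a<..} else UNIV) \<inter> (if t < b then {..<b} else UNIV)"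
  have "a \<le> s \<and> s \<le> b" if "s \<in> I" "s \<in> U" for s
    using a(2,3) b(2,3) that by (fastforce simp: U_def split: if_splits)
  then have "I \<inter> U - {t} = {a..b} \<inter> U - {t}" using sub by auto
  moreover have "t \<in> U" "open U" by (auto simp: U_def)
  ultimately have "at t within I = at t within {a..b}" by (intro at_within_nhd[of t U])
  with that a b sub show ?thesis by blast
qed

text \<open>
  Continuity of \<open>f\<close> is relative to \<open>I\<close>: at an endpoint of \<open>I\<close> the function may jump. The integral
  therefore has to be based inside \<open>I\<close>, which changes it by a constant only.
\<close>

lemma indefinite_integral_has_vector_derivative_within_interval:
  fixes f :: "real \<Rightarrow> 'a::banach"
  assumes int: "\<And>b. f integrable_on {c..b}"
    and I: "is_interval I" "I \<subseteq> {c..}" "t \<in> I"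
    and cont: "continuous_on I f"
  shows "((\<lambda>u. integral {c..u} f) has_vector_derivative f t) (at t within I)"
proof -
  obtain a b where ab: "a \<le> t" "t \<le> b" "{a..b} \<subseteq> I" "at t within I = at t within {a..b}"
    using at_within_interval_eq_at_within_Icc[OF I(1,3)] .
  have "((\<lambda>u. integral {a..u} f) has_vector_derivative f t) (at t within {a..b})"
    using integral_has_vector_derivative continuous_on_subset[OF cont ab(3)] ab(1,2) by auto
  then have shifted: "((\<lambda>u. integral {c..a} f + integral {a..u} f) has_vector_derivative f t)
      (at t within {a..b})"
    using has_vector_derivative_add[OF has_vector_derivative_const] by fastforce
  have split: "integral {c..u} f = integral {c..a} f + integral {a..u} f" if "u \<in> {a..b}" for u
  proof -
    have "a \<in> I" using ab(1-3) by auto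
    then have "c \<le> a" using I(2) by auto
    then show ?thesis
      using Henstock_Kurzweil_Integration.integral_combine[of c a u f] int that by simp
  qed
  have "((\<lambda>u. integral {c..u} f) has_vector_derivative f t) (at t within {a..b})"
  proof (rule has_vector_derivative_transform_within[OF shifted zero_less_one])
    show "t \<in> {a..b}" using ab(1,2) by simp
    show "integral {c..a} f + integral {a..u} f = integral {c..u} f" if "u \<in> {a..b}" for u
      by (rule split[OF that, symmetric])
  qed
  then show ?thesis unfolding ab(4) .
qed

section \<open>Matrices with equal rows\<close>

lemma linear_coord_sum: "linear coord_sum"
  by (rule linearI) (simp_all add: coord_sum_def sum.distrib sum_distrib_left)

lemma linear_equal_rows: "linear equal_rows"
  by (rule linearI) (simp_all add: equal_rows_def vec_eq_iff)

lemma equal_rows_mult: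
  "equal_rows x ** (A :: real ^ 'd ^ 'd) = equal_rows (x v* A)"
  by (simp add: equal_rows_def matrix_matrix_mult_def vector_matrix_mult_def vec_eq_iff)

lemma vector_mult_equal_rows: "x v* equal_rows y = coord_sum x *\<^sub>R y"
  by (simp add: equal_rows_def vector_matrix_mult_def vec_eq_iff coord_sum_def sum_distrib_left
      mult.commute)

lemma matrix_mult_scaled_identity_plus:
  fixes A B :: "real ^ 'd ^ 'd"
  shows "(a *\<^sub>R mat 1 + A) ** (b *\<^sub>R mat 1 + B) = (a * b) *\<^sub>R mat 1 + a *\<^sub>R B + b *\<^sub>R A + A ** B"
proof -
  have "(A + B) ** C = A ** C + B ** C" for A B C :: "real ^ 'd ^ 'd"
    by (simp add: vec_eq_iff matrix_matrix_mult_def sum.distrib distrib_right)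
  then have "(a *\<^sub>R mat 1 + A) ** (b *\<^sub>R mat 1 + B) = b *\<^sub>R (a *\<^sub>R mat 1 + A) + (a *\<^sub>R B + A ** B)"
    by (simp only: matrix_add_ldistrib matrix_scalar_ac scalar_matrix_assoc[symmetric]
        matrix_mul_lid matrix_mul_rid)
  then show ?thesis by (simp only: scaleR_add_right scaleR_scaleR mult.commute add_ac)
qed

text \<open>
  The two factors are the values of \<open>M\<close> and \<open>Q\<close>, and \<open>y - coord_sum y *\<^sub>R x\<close> is the right-hand side of
  the linear equation for \<open>x\<close>. The identity thus turns that vector equation into the matrix equation.
\<close>

lemma matrix_mult_identity_plus_equal_rows:
  fixes x y :: "real ^ 'd"
  shows "((1 - coord_sum x) *\<^sub>R mat 1 + equal_rows x) ** ((- coord_sum y) *\<^sub>R mat 1 + equal_rows y)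
    = equal_rows (y - coord_sum y *\<^sub>R x) - coord_sum (y - coord_sum y *\<^sub>R x) *\<^sub>R mat 1"
proof -
  have "equal_rows x ** equal_rows y = coord_sum x *\<^sub>R equal_rows y"
    by (simp add: equal_rows_mult vector_mult_equal_rows linear_cmul[OF linear_equal_rows])
  moreover have "equal_rows (y - coord_sum y *\<^sub>R x) = equal_rows y - coord_sum y *\<^sub>R equal_rows x"
    "coord_sum (y - coord_sum y *\<^sub>R x) = coord_sum y - coord_sum y * coord_sum x"
    by (simp_all add: linear_diff linear_cmul linear_equal_rows linear_coord_sum)
  ultimately show ?thesis
    by (simp only: matrix_mult_scaled_identity_plus) (simp add: algebra_simps)
qed

text \<open>
  Off the diagonal the multiple of the identity disappears, and with at least two indices every
  column contains an off-diagonal entry.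
\<close>

lemma continuous_on_if_generator_continuous:
  fixes y :: "'a::topological_space \<Rightarrow> real ^ 'd"
  assumes d: "CARD('d) \<ge> 2"
    and cont: "continuous_on I (\<lambda>t. (- coord_sum (y t)) *\<^sub>R mat 1 + equal_rows (y t))"
      (is "continuous_on I ?Q")
  shows "continuous_on I y"
proof -
  have "continuous_on I (\<lambda>t. y t $ j)" for j :: 'd
  proof -
    have "\<exists>i. i \<noteq> j"
    proof (rule ccontr)
      assume "\<not> ?thesis"
      then have "(UNIV :: 'd set) = {j}" by auto
      then have "CARD('d) = 1" by (metis card_1_singleton_iff One_nat_def)
      then show False using d by simp
    qed
    then obtain i where "i \<noteq> j" by blast
    have "continuous_on I (\<lambda>t. ?Q t $ i $ j)"
      by (intro continuous_on_component cont)
    then show ?thesis using \<open>i \<noteq> j\<close> by (simp add: equal_rows_def mat_def)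
  qed
  then have "continuous_on I (\<lambda>t. \<chi> j. y t $ j)" by (intro continuous_on_vec_lambda)
  then show ?thesis by simp
qed

section \<open>The Cauchy problem\<close>

theorem proposition3p2:
  fixes q x :: "real \<Rightarrow> real ^ 'd"
    and Q M :: "real \<Rightarrow> real ^ 'd ^ 'd"
  assumes "CARD('d) \<ge> 2"
    and "piecewise_continuous_on {0..} q"
    and "\<And>t. t \<ge> 0 \<Longrightarrow> Q t = (- coord_sum (q t)) *\<^sub>R mat 1 + equal_rows (q t)"
    and "\<And>t. t \<ge> 0 \<Longrightarrow> x t =
           exp (- integral {0..t} (\<lambda>\<rho>. coord_sum (q \<rho>))) *\<^sub>R
           integral {0..t} (\<lambda>\<tau>. exp (integral {0..\<tau>} (\<lambda>\<sigma>. coord_sum (q \<sigma>))) *\<^sub>R q \<tau>)"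
    and "\<And>t. t \<ge> 0 \<Longrightarrow> M t = (1 - coord_sum (x t)) *\<^sub>R mat 1 + equal_rows (x t)"
  shows "cauchy_solution Q (mat 1) M"
proof -
  define L where "L v = equal_rows v - coord_sum v *\<^sub>R mat 1" for v :: "real ^ 'd"
  define h where "h t = integral {0..t} (\<lambda>\<rho>. coord_sum (q \<rho>))" for t
  define g where "g \<tau> = exp (h \<tau>) *\<^sub>R q \<tau>" for \<tau>
  define y where "y t = integral {0..t} g" for t
  have x_eq: "x t = exp (- h t) *\<^sub>R y t" if "t \<ge> 0" for t
    using assms(4)[OF that] by (simp add: h_def g_def[abs_def] y_def)
  have M_eq: "M t = mat 1 + L (x t)" if "t \<ge> 0" for t
    using assms(5)[OF that] by (simp add: L_def algebra_simps)
  have coord_sum: "bounded_linear (coord_sum :: real ^ 'd \<Rightarrow> real)"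
    using linear_coord_sum linear_conv_bounded_linear by blast
  have "linear L"
    by (rule linearI)
      (simp_all add: L_def linear_add linear_cmul linear_coord_sum linear_equal_rows algebra_simps)
  then have L: "bounded_linear L" using linear_conv_bounded_linear by blast

  have "q integrable_on {0..b}" for b
    by (rule piecewise_continuous_on_integrable[OF assms(2)]) auto
  then have sum_int: "(\<lambda>\<rho>. coord_sum (q \<rho>)) integrable_on {0..b}" for b
    using integrable_linear[OF _ coord_sum, of q] by (simp add: o_def)
  have h_cont: "continuous_on {0..} h"
    unfolding h_def by (intro indefinite_integral_continuous_on_half_line sum_int)
  have "piecewise_continuous_on {0..} g"
    unfolding g_def[abs_def]
    by (intro piecewise_continuous_on_scaleR assms(2) continuous_intros h_cont)
  then have g_int: "g integrable_on {0..b}" for b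
    by (rule piecewise_continuous_on_integrable) auto
  have y_cont: "continuous_on {0..} y"
    unfolding y_def by (intro indefinite_integral_continuous_on_half_line g_int)

  \<comment> \<open>The formulas for \<open>x\<close> and \<open>M\<close> hold for nonnegative times only, so continuity and derivatives are
    first established for the explicit expression and then transferred.\<close>
  have M_cont: "continuous_on {0..} M"
  proof -
    have "continuous_on {0..} (\<lambda>t. mat 1 + L (exp (- h t) *\<^sub>R y t))"
      by (intro continuous_intros bounded_linear.continuous_on[OF L] h_cont y_cont)
    then show ?thesis by (rule continuous_on_eq) (simp add: M_eq x_eq)
  qed
  have M_0: "M 0 = mat 1"
    using linear_0[OF \<open>linear L\<close>] by (simp add: M_eq x_eq y_def)
  have "(M has_vector_derivative (M t ** Q t)) (at t within I)"
    if I: "is_interval I" "I \<subseteq> {0..}" and Q_cont: "continuous_on I Q" and t: "t \<in> I" for I t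
  proof -
    have nonneg: "s \<ge> 0" if "s \<in> I" for s using that I by auto
    have "continuous_on I (\<lambda>t. (- coord_sum (q t)) *\<^sub>R mat 1 + equal_rows (q t))"
      by (rule continuous_on_eq[OF Q_cont]) (simp add: assms(3) nonneg)
    then have q_cont: "continuous_on I q"
      using continuous_on_if_generator_continuous[OF assms(1)] by blast
    have h_der: "(h has_real_derivative coord_sum (q t)) (at t within I)"
      unfolding h_def has_real_derivative_iff_has_vector_derivative
      by (intro indefinite_integral_has_vector_derivative_within_interval sum_int I t
          bounded_linear.continuous_on[OF coord_sum q_cont])
    have "continuous_on I g"
      unfolding g_def[abs_def]
      by (intro continuous_intros q_cont continuous_on_subset[OF h_cont] I)
    then have y_der: "(y has_vector_derivative g t) (at t within I)"
      unfolding y_def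
      by (intro indefinite_integral_has_vector_derivative_within_interval g_int I t)
    \<comment> \<open>The product rule gives the linear equation \<open>x' = q - coord_sum q *\<^sub>R x\<close>.\<close>
    have "((\<lambda>t. exp (- h t) *\<^sub>R y t) has_vector_derivative
        exp (- h t) *\<^sub>R g t + (exp (- h t) * - coord_sum (q t)) *\<^sub>R y t) (at t within I)"
      by (rule has_vector_derivative_scaleR[OF _ y_der])
        (auto intro!: derivative_eq_intros h_der)
    moreover have "exp (- h t) *\<^sub>R g t + (exp (- h t) * - coord_sum (q t)) *\<^sub>R y t
        = q t - coord_sum (q t) *\<^sub>R x t"
      using x_eq[OF nonneg[OF t]] by (simp add: g_def exp_minus algebra_simps)
    ultimately have "((\<lambda>t. exp (- h t) *\<^sub>R y t) has_vector_derivative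
        q t - coord_sum (q t) *\<^sub>R x t) (at t within I)" by simp
    then have "((\<lambda>t. mat 1 + L (exp (- h t) *\<^sub>R y t)) has_vector_derivative
        0 + L (q t - coord_sum (q t) *\<^sub>R x t)) (at t within I)"
      by (intro has_vector_derivative_add has_vector_derivative_const
          bounded_linear.has_vector_derivative[OF L])
    moreover have "0 + L (q t - coord_sum (q t) *\<^sub>R x t) = M t ** Q t"
      unfolding assms(3)[OF nonneg[OF t]] assms(5)[OF nonneg[OF t]]
        matrix_mult_identity_plus_equal_rows by (simp add: L_def)
    ultimately have "((\<lambda>t. mat 1 + L (exp (- h t) *\<^sub>R y t)) has_vector_derivative M t ** Q t)
        (at t within I)" by simp
    then show ?thesis
      by (rule has_vector_derivative_transform_within[OF _ zero_less_one t])
        (simp add: M_eq x_eq nonneg)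
  qed
  with M_cont M_0 show ?thesis unfolding cauchy_solution_def by blast
qed

end
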